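(* The ring $\mathcal{R}_q^{+}$ is freely generated as a $\mathbb{Z}[q]$-module by the $q$-binomial coefficient polynomials $\genfrac{[}{]}{0pt}{}{x}{k}$ for $k\in\mathbb{N}$, defined by $$\genfrac{[}{]}{0pt}{}{x}{k}:=\frac{x(x-[1]_q)\cdots(x-[k-1]_q)}{q^{\binom{k}{2}}[k]_q!}\quad\text{if }k\ge1,\qquad \genfrac{[}{]}{0pt}{}{x}{0}:=1.$$ Moreover, these polynomials satisfy $\genfrac{[}{]}{0pt}{}{[n]_q}{k}=\genfrac{[}{]}{0pt}{}{n}{k}_q$ for all $n,k\in\mathbb{N}$, where the left-hand side denotes the evaluation of $\genfrac{[}{]}{0pt}{}{x}{k}$ at $x=[n]_q$.
   Context: Here $q$ and $x$ are commuting indeterminates, $\mathbb{N}=\{0,1,2,\dots\}$. For $n\in\mathbb{N}$, $[n]_q:=(q^n-1)/(q-1)=1+q+\cdots+q^{n-1}$ (with $[0]_q=0$), and $[n]_q!:=[n]_q[n-1]_q\cdots[1]_q$ with $[0]_q!:=1$. For $n,k\in\mathbb{N}$, $\genfrac{[}{]}{0pt}{}{n}{k}_q:=\frac{[n]_q!}{[n-k]_q![k]_q!}$ if $k\le n$ and $0$ if $k>n$. The $\mathbb{Z}[q]$-algebra $\mathcal{R}_q^{+}$ is $\{P(x)\in\mathbb{Q}(q)[x] : P([n]_q)\in\mathbb{Z}[q]\text{ for all }n\in\mathbb{N}\}$. *)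

theory Defs
  imports "HOL-Computational_Algebra.Computational_Algebra"
begin

text \<open>The field of rational functions in the indeterminate \<open>q\<close> is the fraction field of the
  polynomial ring in one indeterminate over the rationals.\<close>

type_synonym Qq = "rat poly fract"

definition q :: Qq where
  "q = to_fract (monom 1 1)"

text \<open>The embedding of integer polynomials in \<open>q\<close> into rational functions in \<open>q\<close>.\<close>

definition Zq_embed :: "int poly \<Rightarrow> Qq" where
  "Zq_embed p = to_fract (map_poly of_int p)"

lemma Zq_embed_0 [simp]: "Zq_embed 0 = 0"
  by (simp add: Zq_embed_def)

lemma Zq_embed_1 [simp]: "Zq_embed 1 = 1"
  by (simp add: Zq_embed_def map_poly_1 flip: one_pCons)

lemma Zq_embed_add [simp]: "Zq_embed (p + r) = Zq_embed p + Zq_embed r"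
proof -
  have "map_poly (of_int :: int \<Rightarrow> rat) (p + r) = map_poly of_int p + map_poly of_int r"
    by (rule poly_eqI) (simp add: coeff_map_poly)
  then show ?thesis by (simp add: Zq_embed_def)
qed

lemma Zq_embed_mult [simp]: "Zq_embed (p * r) = Zq_embed p * Zq_embed r"
proof -
  have "map_poly (of_int :: int \<Rightarrow> rat) (p * r) = map_poly of_int p * map_poly of_int r"
    by (rule poly_eqI) (simp add: coeff_map_poly coeff_mult)
  then show ?thesis by (simp add: Zq_embed_def)
qed

lemma Zq_embed_eq_iff [simp]: "Zq_embed p = Zq_embed r \<longleftrightarrow> p = r"
  by (auto simp: Zq_embed_def poly_eq_iff coeff_map_poly)

lemma Zq_embed_q: "Zq_embed (monom 1 1) = q"
  by (simp add: Zq_embed_def q_def map_poly_monom)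

definition Zq_scale :: "int poly \<Rightarrow> Qq poly \<Rightarrow> Qq poly" where
  "Zq_scale a P = smult (Zq_embed a) P"

global_interpretation Zq: module Zq_scale
  by unfold_locales (simp_all add: Zq_scale_def smult_add_right smult_add_left)

definition q_int :: "nat \<Rightarrow> Qq" where
  "q_int n = (q ^ n - 1) / (q - 1)"

definition q_fact :: "nat \<Rightarrow> Qq" where
  "q_fact n = (\<Prod>i=1..n. q_int i)"

definition q_binomial :: "nat \<Rightarrow> nat \<Rightarrow> Qq" where
  "q_binomial n k = (if k \<le> n then q_fact n / (q_fact (n - k) * q_fact k) else 0)"

lemma q_neq_1: "q \<noteq> 1"
proof -
  have "monom 1 1 \<noteq> (1 :: rat poly)"
    by (simp add: poly_eq_iff exI[of _ 0])
  then show ?thesis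
    by (simp add: q_def flip: to_fract_1)
qed

text \<open>In particular the denominator \<open>q - 1\<close> above is nonzero.\<close>

lemma q_int_eq_sum: "q_int n = (\<Sum>i<n. q ^ i)"
  using q_neq_1 by (simp add: q_int_def sum_gp_strict divide_simps) (simp add: algebra_simps)

definition Rq_plus :: "Qq poly set" where
  "Rq_plus = {P. \<forall>n. poly P (q_int n) \<in> range Zq_embed}"

text \<open>\<open>Rq_plus\<close> is a submodule, contains 1 and is closed under products, so it is indeed
  an algebra over the integer polynomials in \<open>q\<close>.\<close>

lemma Rq_plus_subspace: "Zq.subspace Rq_plus"
  unfolding Zq.subspace_def Rq_plus_def Zq_scale_def
proof (safe)
  fix n show "poly 0 (q_int n) \<in> range Zq_embed"
    using rangeI[of Zq_embed 0] by simp
next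
  fix x y n
  assume "\<forall>n. poly x (q_int n) \<in> range Zq_embed" "\<forall>n. poly y (q_int n) \<in> range Zq_embed"
  then show "poly (x + y) (q_int n) \<in> range Zq_embed"
    by (auto simp: image_iff) (metis Zq_embed_add)
next
  fix c x n
  assume "\<forall>n. poly x (q_int n) \<in> range Zq_embed"
  then show "poly (smult (Zq_embed c) x) (q_int n) \<in> range Zq_embed"
    by (auto simp: image_iff) (metis Zq_embed_mult)
qed

lemma Rq_plus_1: "1 \<in> Rq_plus"
  using rangeI[of Zq_embed 1] by (simp add: Rq_plus_def)

lemma Rq_plus_mult: "x \<in> Rq_plus \<Longrightarrow> y \<in> Rq_plus \<Longrightarrow> x * y \<in> Rq_plus"
  by (auto simp: Rq_plus_def image_iff) (metis Zq_embed_mult)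

text \<open>The factor for \<open>i = 0\<close> is the indeterminate \<open>x\<close> itself, and for \<open>k = 0\<close> the products are
  empty.\<close>

definition q_binomial_poly :: "nat \<Rightarrow> Qq poly" where
  "q_binomial_poly k =
     smult (1 / (q ^ (k choose 2) * q_fact k)) (\<Prod>i<k. [:- q_int i, 1:])"

lemma q_binomial_poly_0: "q_binomial_poly 0 = 1"
  by (simp add: q_binomial_poly_def q_fact_def numeral_2_eq_2)

end

theory Submission
  imports Defs
begin

text \<open>
  The key is the behaviour of the \<open>q\<close>-binomial polynomials \<open>B\<^sub>k\<close> at the points \<open>[n]\<^sub>q\<close>.
  Since \<open>[n]\<^sub>q - [i]\<^sub>q = q\<^sup>i [n - i]\<^sub>q\<close>, the linear factors of \<open>B\<^sub>k([n]\<^sub>q)\<close> contribute the powers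
  of \<open>q\<close> that its denominator cancels, and the value is the \<open>q\<close>-binomial coefficient.
  The latter is an integer polynomial in \<open>q\<close> by the \<open>q\<close>-Pascal recursion, so each \<open>B\<^sub>k\<close> lies in
  the ring.

  Moreover, the matrix of values \<open>B\<^sub>k([n]\<^sub>q)\<close> is unitriangular: it vanishes for \<open>n < k\<close> and is \<open>1\<close>
  for \<open>n = k\<close>. Hence a nontrivial linear relation between the \<open>B\<^sub>k\<close> is refuted by evaluating it
  at \<open>[k]\<^sub>q\<close> for the least \<open>k\<close> with nonzero coefficient. Conversely, Newton interpolation
  at \<open>[0]\<^sub>q, \<dots>, [m]\<^sub>q\<close> divides only by the diagonal entries \<open>1\<close>: an element of the ring is
  interpolated there by a combination of \<open>B\<^sub>0, \<dots>, B\<^sub>m\<close> with coefficients in \<open>\<int>[q]\<close>. The points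
  \<open>[n]\<^sub>q\<close> are pairwise distinct, so for \<open>m\<close> the degree of the element the interpolant is the
  element itself.
\<close>

section \<open>The points of evaluation\<close>

lemma Zq_embed_power: "Zq_embed (p ^ n) = Zq_embed p ^ n"
  by (induction n) simp_all

lemma q_power_eq_embed: "q ^ n = Zq_embed (monom 1 n)"
  unfolding Zq_embed_q[symmetric] Zq_embed_power[symmetric] by (simp add: monom_power)

lemma q_power_eq_iff: "q ^ m = q ^ n \<longleftrightarrow> m = n"
  by (simp add: q_power_eq_embed monom_eq_iff')

lemma q_nonzero: "q \<noteq> 0"
  by (simp add: q_def)

lemma inj_q_int: "inj q_int"
  using q_neq_1 by (intro injI) (simp add: q_int_def q_power_eq_iff)

lemma q_int_0 [simp]: "q_int 0 = 0"
  by (simp add: q_int_def)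

lemma q_int_eq_0_iff: "q_int n = 0 \<longleftrightarrow> n = 0"
  using inj_eq[OF inj_q_int, of n 0] by simp

lemma q_int_add: "q_int (m + n) = q_int m + q ^ m * q_int n"
  using q_neq_1 by (simp add: q_int_def power_add divide_simps) (simp add: algebra_simps)

lemma q_fact_0: "q_fact 0 = 1"
  by (simp add: q_fact_def)

lemma q_fact_Suc: "q_fact (Suc n) = q_int (Suc n) * q_fact n"
  by (simp add: q_fact_def mult.commute)

lemma q_fact_nonzero: "q_fact n \<noteq> 0"
  by (simp add: q_fact_def q_int_eq_0_iff)

section \<open>Integrality of the q-binomial coefficients\<close>

lemma q_binomial_0_right: "q_binomial n 0 = 1"
  by (simp add: q_binomial_def q_fact_0 q_fact_nonzero)

lemma q_binomial_self: "q_binomial n n = 1"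
  by (simp add: q_binomial_def q_fact_0 q_fact_nonzero)

lemma q_binomial_eq_0: "n < k \<Longrightarrow> q_binomial n k = 0"
  by (simp add: q_binomial_def)

text \<open>Over a common denominator this is the splitting
  \<open>[n + 1]\<^sub>q = [k + 1]\<^sub>q + q\<^bsup>k+1\<^esup> [n - k]\<^sub>q\<close>.\<close>

lemma q_binomial_Suc_Suc:
  "q_binomial (Suc n) (Suc k) = q_binomial n k + q ^ Suc k * q_binomial n (Suc k)"
proof (cases n k rule: linorder_cases)
  case greater
  then obtain d where n: "n = Suc (k + d)"
    using less_imp_Suc_add by blast
  have "q_int (Suc n) = q_int (Suc k) + q ^ Suc k * q_int (Suc d)"
    using q_int_add[of "Suc k" "Suc d"] by (simp add: n)
  moreover have "n - k = Suc d" "n - Suc k = d" "k < n"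
    by (simp_all add: n)
  ultimately show ?thesis
    by (simp add: q_binomial_def q_fact_Suc[of n] q_fact_Suc[of k] q_fact_Suc[of d]
          q_fact_nonzero q_int_eq_0_iff divide_simps del: power_Suc)
       (simp add: algebra_simps)
qed (simp_all add: q_binomial_eq_0 q_binomial_self)

lemma q_binomial_in_range_embed: "q_binomial n k \<in> range Zq_embed"
proof (induction n arbitrary: k)
  case 0
  have "q_binomial 0 k = Zq_embed (if k = 0 then 1 else 0)"
    by (simp add: q_binomial_0_right q_binomial_eq_0)
  then show ?case by blast
next
  case (Suc n)
  show ?case
  proof (cases k)
    case 0
    then show ?thesis
      using rangeI[of Zq_embed 1] by (simp add: q_binomial_0_right)
  next
    case (Suc j)
    obtain a b where "q_binomial n j = Zq_embed a" "q_binomial n (Suc j) = Zq_embed b"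
      using Suc.IH by blast
    then have "q_binomial (Suc n) k = Zq_embed (a + monom 1 (Suc j) * b)"
      by (simp add: Suc q_binomial_Suc_Suc q_power_eq_embed del: power_Suc)
    then show ?thesis by blast
  qed
qed

section \<open>Values of the q-binomial polynomials\<close>

text \<open>Each factor is \<open>[n]\<^sub>q - [i]\<^sub>q = q\<^sup>i [n - i]\<^sub>q\<close>; the exponents \<open>0, \<dots>, k - 1\<close> add up to
  \<open>k choose 2\<close>, and \<open>[n - k]\<^sub>q!\<close> completes the falling product of the \<open>[n - i]\<^sub>q\<close>
  to \<open>[n]\<^sub>q!\<close>.\<close>

lemma prod_q_int_diff:
  assumes "k \<le> n"
  shows "(\<Prod>i<k. q_int n - q_int i) * q_fact (n - k) = q ^ (k choose 2) * q_fact n"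
  using assms
proof (induction k)
  case 0
  then show ?case by (simp add: numeral_2_eq_2)
next
  case (Suc k)
  have "q_int n - q_int k = q ^ k * q_int (n - k)"
    using q_int_add[of k "n - k"] Suc.prems by simp
  moreover have "q_fact (n - k) = q_int (n - k) * q_fact (n - Suc k)"
    using q_fact_Suc[of "n - Suc k"] Suc.prems by (simp add: Suc_diff_Suc)
  ultimately have "(\<Prod>i<Suc k. q_int n - q_int i) * q_fact (n - Suc k)
      = q ^ k * ((\<Prod>i<k. q_int n - q_int i) * q_fact (n - k))"
    by (simp add: mult_ac)
  also have "\<dots> = q ^ (Suc k choose 2) * q_fact n"
    using Suc by (simp add: power_add numeral_2_eq_2)
  finally show ?case .
qed

theorem poly_q_binomial_poly_q_int: "poly (q_binomial_poly k) (q_int n) = q_binomial n k"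
proof (cases "k \<le> n")
  case True
  then show ?thesis
    using prod_q_int_diff[OF True]
    by (simp add: q_binomial_poly_def q_binomial_def poly_prod divide_simps
          q_fact_nonzero q_nonzero mult_ac)
next
  case False
  then have "(\<Prod>i<k. q_int n - q_int i) = 0"
    by (intro prod_zero) (auto intro!: bexI[of _ n])
  with False show ?thesis
    by (simp add: q_binomial_poly_def q_binomial_def poly_prod)
qed

lemma q_binomial_poly_in_Rq_plus: "q_binomial_poly k \<in> Rq_plus"
  by (simp add: Rq_plus_def poly_q_binomial_poly_q_int q_binomial_in_range_embed)

lemma degree_q_binomial_poly: "degree (q_binomial_poly k) \<le> k"
proof -
  have "degree (\<Prod>i<k. [:- q_int i, 1:]) \<le> k"
    using degree_prod_sum_le[of "{..<k}" "\<lambda>i. [:- q_int i, 1:]"] by simp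
  then show ?thesis
    unfolding q_binomial_poly_def by (intro order.trans[OF degree_smult_le]) simp
qed

section \<open>Freeness\<close>

lemma inj_q_binomial_poly: "inj q_binomial_poly"
proof (rule linorder_injI)
  fix j k :: nat
  assume "j < k"
  then have "poly (q_binomial_poly j) (q_int j) \<noteq> poly (q_binomial_poly k) (q_int j)"
    by (simp add: poly_q_binomial_poly_q_int q_binomial_self q_binomial_eq_0)
  then show "q_binomial_poly j \<noteq> q_binomial_poly k" by auto
qed

text \<open>Evaluating a relation at \<open>[k]\<^sub>q\<close> kills the terms with index above \<open>k\<close>; if the coefficients
  with index below \<open>k\<close> are already known to vanish, only the coefficient of \<open>B\<^sub>k\<close> is left.\<close>

lemma independent_q_binomial_poly: "Zq.independent (range q_binomial_poly)"
  unfolding Zq.independent_explicit_module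
proof (intro allI impI)
  fix t u v
  assume "finite t" "t \<subseteq> range q_binomial_poly"
    and sum_0: "(\<Sum>w\<in>t. Zq_scale (u w) w) = 0" and "v \<in> t"
  then obtain I where t: "t = q_binomial_poly ` I"
    by (meson subset_imageE)
  have fin: "finite I"
    using \<open>finite t\<close> inj_q_binomial_poly by (auto simp: t finite_image_iff inj_on_def)
  define c where "c = u \<circ> q_binomial_poly"
  have relation: "(\<Sum>k\<in>I. Zq_embed (c k) * q_binomial n k) = 0" for n
  proof -
    have "(\<Sum>k\<in>I. Zq_scale (c k) (q_binomial_poly k)) = 0"
      using sum_0 inj_on_subset[OF inj_q_binomial_poly]
      by (simp add: t sum.reindex c_def)
    then have "poly (\<Sum>k\<in>I. Zq_scale (c k) (q_binomial_poly k)) (q_int n) = 0"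
      by simp
    then show ?thesis
      by (simp add: poly_sum Zq_scale_def poly_q_binomial_poly_q_int)
  qed
  have coeff_0: "k \<in> I \<Longrightarrow> c k = 0" for k
  proof (induction k rule: less_induct)
    case (less k)
    have "Zq_embed (c j) * q_binomial k j = 0" if "j \<in> I - {k}" for j
    proof (cases "j < k")
      case True
      with less.IH that show ?thesis by simp
    next
      case False
      with that show ?thesis by (simp add: q_binomial_eq_0)
    qed
    then have "(\<Sum>j\<in>I - {k}. Zq_embed (c j) * q_binomial k j) = 0"
      by (rule sum.neutral[OF ballI])
    then have "Zq_embed (c k) * q_binomial k k = 0"
      using relation[of k] by (simp add: sum.remove[OF fin less.prems])
    then have "Zq_embed (c k) = Zq_embed 0"
      by (simp add: q_binomial_self)
    then show ?case
      by (simp only: Zq_embed_eq_iff)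
  qed
  with \<open>v \<in> t\<close> show "u v = 0"
    by (auto simp: t c_def)
qed

section \<open>Generation by Newton interpolation\<close>

lemma span_q_binomial_poly_subset: "Zq.span (range q_binomial_poly) \<subseteq> Rq_plus"
  by (rule Zq.span_minimal) (auto simp: q_binomial_poly_in_Rq_plus Rq_plus_subspace)

text \<open>Adding a multiple of \<open>B\<^sub>m\<close> does not disturb the values already attained at
  \<open>[0]\<^sub>q, \<dots>, [m - 1]\<^sub>q\<close>, and the multiple needed at \<open>[m]\<^sub>q\<close> is the defect there because
  \<open>B\<^sub>m([m]\<^sub>q) = 1\<close>. The defect lies in \<open>\<int>[q]\<close> because the span stays inside the ring.\<close>

lemma Newton_interpolation:
  assumes "P \<in> Rq_plus"
  shows "\<exists>S \<in> Zq.span (range q_binomial_poly).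
    degree S \<le> m \<and> (\<forall>i\<le>m. poly S (q_int i) = poly P (q_int i))"
proof -
  have extend: "\<exists>S' \<in> Zq.span (range q_binomial_poly).
      degree S' \<le> m \<and> (\<forall>i\<le>m. poly S' (q_int i) = poly P (q_int i))"
    if S: "S \<in> Zq.span (range q_binomial_poly)" "degree S \<le> m"
      and eq: "\<And>i. i < m \<Longrightarrow> poly S (q_int i) = poly P (q_int i)" for S m
  proof -
    have "P - S \<in> Rq_plus"
      using S span_q_binomial_poly_subset assms by (intro Zq.subspace_diff Rq_plus_subspace) auto
    then obtain c where c: "poly (P - S) (q_int m) = Zq_embed c"
      by (auto simp: Rq_plus_def)
    define S' where "S' = S + Zq_scale c (q_binomial_poly m)"
    have "S' \<in> Zq.span (range q_binomial_poly)"
      unfolding S'_def using S(1) by (intro Zq.span_add Zq.span_scale) (auto intro: Zq.span_base)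
    moreover have "degree S' \<le> m"
      unfolding S'_def Zq_scale_def
      using S degree_q_binomial_poly order.trans[OF degree_smult_le] by (intro degree_add_le) auto
    moreover have "poly S' (q_int i) = poly P (q_int i)" if "i \<le> m" for i
      using that eq[of i] c
      by (cases "i = m")
         (auto simp: S'_def Zq_scale_def poly_q_binomial_poly_q_int q_binomial_self
           q_binomial_eq_0 algebra_simps)
    ultimately show ?thesis by blast
  qed
  show ?thesis
  proof (induction m)
    case 0
    show ?case
      by (rule extend[of 0]) (simp_all add: Zq.span_zero)
  next
    case (Suc m)
    then obtain S where "S \<in> Zq.span (range q_binomial_poly)" "degree S \<le> m"
      "\<forall>i\<le>m. poly S (q_int i) = poly P (q_int i)"
      by blast
    then show ?case
      by (intro extend[of S]) auto
  qed
qed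

lemma span_q_binomial_poly: "Zq.span (range q_binomial_poly) = Rq_plus"
proof
  show "Zq.span (range q_binomial_poly) \<subseteq> Rq_plus"
    by (rule span_q_binomial_poly_subset)
  show "Rq_plus \<subseteq> Zq.span (range q_binomial_poly)"
  proof
    fix P assume "P \<in> Rq_plus"
    then obtain S where S: "S \<in> Zq.span (range q_binomial_poly)" "degree S \<le> degree P"
      "\<forall>i\<le>degree P. poly S (q_int i) = poly P (q_int i)"
      using Newton_interpolation by blast
    have "card (q_int ` {..degree P}) = Suc (degree P)"
      using inj_on_subset[OF inj_q_int] by (simp add: card_image)
    then have "S = P"
      using S by (intro poly_eqI_degree[of "q_int ` {..degree P}"]) auto
    with S show "P \<in> Zq.span (range q_binomial_poly)" by simp
  qed
qed

theorem proposition1p2: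
  shows "inj q_binomial_poly
    \<and> Zq.independent (range q_binomial_poly)
    \<and> Zq.span (range q_binomial_poly) = Rq_plus
    \<and> (\<forall>n k. poly (q_binomial_poly k) (q_int n) = q_binomial n k)"
  using inj_q_binomial_poly independent_q_binomial_poly span_q_binomial_poly
    poly_q_binomial_poly_q_int by blast

end
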